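(* Let $(\Omega,\mathcal B,\mu)$ be a measure space (no finiteness, $\sigma$-finiteness or localizability is assumed). Then the real Banach space $L^\infty(\Omega)=L^\infty(\Omega,\mathcal B,\mu)$, with its norm metric $(f,g)\mapsto\|f-g\|_\infty$, is Gromov-compactifiable if and only if $\mu(\Omega)=0$ or $\mu$ has an atom.
   Context: Scalars are real. A set $A\in\mathcal B$ is an atom of $\mu$ if $\mu(A)>0$ and every measurable $E\subset A$ satisfies $\mu(E)=0$ or $\mu(A\setminus E)=0$. Gromov-compactifiability: for a (nonempty) metric space $(Y,\varrho)$ and a base point $y_0\in Y$, the horofunction map is $h_{y_0}\colon Y\to\mathbb R^Y$, $h_{y_0}(z)(y):=\varrho(y,z)-\varrho(y_0,z)$, where $\mathbb R^Y$ carries the topology of pointwise convergence. The map $h_{y_0}$ is continuous and injective. $(Y,\varrho)$ is called Gromov-compactifiable if $h_{y_0}$ is a topological embedding (a homeomorphism onto its image); this does not depend on the choice of $y_0$. *)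

theory Defs
  imports "HOL-Probability.Essential_Supremum"
begin

context Metric_space
begin

definition horofunction :: "'a \<Rightarrow> 'a \<Rightarrow> ('a \<Rightarrow> real)" where
  "horofunction y0 z = (\<lambda>y\<in>M. d y z - d y0 z)"

text \<open>The choice of the base point is immaterial, see \<open>Gromov_compactifiable_iff\<close> below;
  the existential quantifier forces the space to be nonempty.\<close>

definition Gromov_compactifiable :: bool where
  "Gromov_compactifiable \<longleftrightarrow> (\<exists>y0\<in>M. embedding_map mtopology (powertop_real M) (horofunction y0))"

lemma embedding_map_horofunction_change_base:
  assumes a: "a \<in> M" and b: "b \<in> M"
    and emb: "embedding_map mtopology (powertop_real M) (horofunction a)"
  shows "embedding_map mtopology (powertop_real M) (horofunction b)"
proof -
  define T where "T = (\<lambda>c g. \<lambda>y\<in>M. g y - g c :: real)"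
  have cont: "continuous_map (powertop_real M) (powertop_real M) (T c)" if "c \<in> M" for c
    unfolding T_def using that
    by (auto simp: continuous_map_componentwise intro!: continuous_intros)
  have T: "T c (horofunction e z) = horofunction c z" if "c \<in> M" for c e z
    using that by (auto simp: T_def horofunction_def)
  have "homeomorphic_maps (subtopology (powertop_real M) (horofunction a ` M))
      (subtopology (powertop_real M) (horofunction b ` M)) (T b) (T a)"
    unfolding homeomorphic_maps_def
    using cont[OF a] cont[OF b] T[OF a] T[OF b]
    by (auto simp: continuous_map_in_subtopology intro: continuous_map_from_subtopology)
  then have "homeomorphic_map (subtopology (powertop_real M) (horofunction a ` M))
      (subtopology (powertop_real M) (horofunction b ` M)) (T b)"
    using homeomorphic_map_maps by blast
  then have "homeomorphic_map mtopology
      (subtopology (powertop_real M) (horofunction b ` M)) (T b \<circ> horofunction a)"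
    using emb homeomorphic_map_compose unfolding embedding_map_def by fastforce
  moreover have "T b \<circ> horofunction a = horofunction b"
    using T[OF b] by auto
  ultimately show ?thesis
    by (simp add: embedding_map_def)
qed

lemma Gromov_compactifiable_iff:
  assumes "y0 \<in> M"
  shows "Gromov_compactifiable \<longleftrightarrow> embedding_map mtopology (powertop_real M) (horofunction y0)"
  using assms embedding_map_horofunction_change_base unfolding Gromov_compactifiable_def by blast

end

text \<open>The essential supremum is taken in \<^typ>\<open>ennreal\<close>, whose least element is 0, so that the
  seminorm is 0 also when the whole space is null.\<close>

definition ess_bounded :: "'a measure \<Rightarrow> ('a \<Rightarrow> real) set" where
  "ess_bounded M = {f \<in> borel_measurable M. esssup M (\<lambda>x. ennreal \<bar>f x\<bar>) < \<infinity>}"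

definition Linf_norm :: "'a measure \<Rightarrow> ('a \<Rightarrow> real) \<Rightarrow> real" where
  "Linf_norm M f = enn2real (esssup M (\<lambda>x. ennreal \<bar>f x\<bar>))"

text \<open>Values outside the measure space are ignored by the almost-everywhere relation, so classes of
  total functions correspond to classes of functions on that set.\<close>

definition AE_eq_rel :: "'a measure \<Rightarrow> (('a \<Rightarrow> real) \<times> ('a \<Rightarrow> real)) set" where
  "AE_eq_rel M = {(f, g). f \<in> ess_bounded M \<and> g \<in> ess_bounded M \<and> (AE x in M. f x = g x)}"

definition Linf :: "'a measure \<Rightarrow> ('a \<Rightarrow> real) set set" where
  "Linf M = ess_bounded M // AE_eq_rel M"

text \<open>The norm of the difference of two classes, computed on arbitrary representatives; the
  choice does not matter by \<open>Linf_dist_eq\<close> below.\<close>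

definition Linf_dist :: "'a measure \<Rightarrow> ('a \<Rightarrow> real) set \<Rightarrow> ('a \<Rightarrow> real) set \<Rightarrow> real" where
  "Linf_dist M F G = Linf_norm M (\<lambda>x. (SOME f. f \<in> F) x - (SOME g. g \<in> G) x)"

lemma equiv_AE_eq_rel: "equiv (ess_bounded M) (AE_eq_rel M)"
proof (rule equivI)
  show "trans (AE_eq_rel M)"
    unfolding AE_eq_rel_def trans_def by (auto elim: eventually_elim2)
qed (auto simp: AE_eq_rel_def refl_on_def sym_def eq_commute)

lemma ess_bounded_measurable [measurable_dest]: "f \<in> ess_bounded M \<Longrightarrow> f \<in> borel_measurable M"
  by (simp add: ess_bounded_def)

lemma esssup_diff_triangle:
  fixes f g h :: "'a \<Rightarrow> real"
  assumes [measurable]: "f \<in> borel_measurable M" "g \<in> borel_measurable M" "h \<in> borel_measurable M"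
  shows "esssup M (\<lambda>x. ennreal \<bar>f x - h x\<bar>)
    \<le> esssup M (\<lambda>x. ennreal \<bar>f x - g x\<bar>) + esssup M (\<lambda>x. ennreal \<bar>g x - h x\<bar>)"
proof (rule esssup_I)
  show "AE x in M. ennreal \<bar>f x - h x\<bar>
    \<le> esssup M (\<lambda>x. ennreal \<bar>f x - g x\<bar>) + esssup M (\<lambda>x. ennreal \<bar>g x - h x\<bar>)"
    using esssup_AE[of "\<lambda>x. ennreal \<bar>f x - g x\<bar>" M] esssup_AE[of "\<lambda>x. ennreal \<bar>g x - h x\<bar>" M]
  proof eventually_elim
    case (elim x)
    have "ennreal \<bar>f x - h x\<bar> \<le> ennreal \<bar>f x - g x\<bar> + ennreal \<bar>g x - h x\<bar>"
      by (simp flip: ennreal_plus add: ennreal_leI)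
    also have "\<dots> \<le> esssup M (\<lambda>x. ennreal \<bar>f x - g x\<bar>) + esssup M (\<lambda>x. ennreal \<bar>g x - h x\<bar>)"
      by (intro add_mono elim)
    finally show ?case .
  qed
qed measurable

lemma esssup_diff_finite:
  assumes "f \<in> ess_bounded M" "g \<in> ess_bounded M"
  shows "esssup M (\<lambda>x. ennreal \<bar>f x - g x\<bar>) < \<infinity>"
proof -
  have "esssup M (\<lambda>x. ennreal \<bar>f x - g x\<bar>)
    \<le> esssup M (\<lambda>x. ennreal \<bar>f x - 0\<bar>) + esssup M (\<lambda>x. ennreal \<bar>0 - g x\<bar>)"
    using assms by (intro esssup_diff_triangle) (auto simp: ess_bounded_def)
  also have "\<dots> < \<infinity>"
    using assms by (simp add: ess_bounded_def)
  finally show ?thesis .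
qed

lemma Linf_dist_eq:
  assumes F: "F \<in> Linf M" "f \<in> F" and G: "G \<in> Linf M" "g \<in> G"
  shows "Linf_dist M F G = Linf_norm M (\<lambda>x. f x - g x)"
proof -
  define f' g' where "f' = (SOME f. f \<in> F)" and "g' = (SOME g. g \<in> G)"
  have "f' \<in> F" "g' \<in> G"
    using someI[of "\<lambda>f. f \<in> F", OF F(2)] someI[of "\<lambda>g. g \<in> G", OF G(2)]
    by (auto simp: f'_def g'_def)
  then have "(f', f) \<in> AE_eq_rel M" "(g', g) \<in> AE_eq_rel M"
    using F G unfolding Linf_def
    by (blast intro: in_quotient_imp_in_rel[OF equiv_AE_eq_rel])+
  then have AE: "AE x in M. f' x = f x" "AE x in M. g' x = g x"
    and [measurable]: "f \<in> borel_measurable M" "g \<in> borel_measurable M"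
      "f' \<in> borel_measurable M" "g' \<in> borel_measurable M"
    by (auto simp: AE_eq_rel_def ess_bounded_def)
  have "esssup M (\<lambda>x. ennreal \<bar>f' x - g' x\<bar>) = esssup M (\<lambda>x. ennreal \<bar>f x - g x\<bar>)"
    by (rule esssup_AE_cong) (measurable, use AE in \<open>eventually_elim, simp\<close>)
  then show ?thesis
    by (simp add: Linf_dist_def Linf_norm_def f'_def g'_def)
qed

lemma Linf_rep:
  assumes "F \<in> Linf M"
  obtains f where "f \<in> F" "f \<in> ess_bounded M" "F = AE_eq_rel M `` {f}"
  using assms equiv_class_self[OF equiv_AE_eq_rel] unfolding Linf_def quotient_def by auto

lemma Metric_space_Linf: "Metric_space (Linf M) (Linf_dist M)"
proof
  fix F G :: "('a \<Rightarrow> real) set"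
  show "0 \<le> Linf_dist M F G"
    by (simp add: Linf_dist_def Linf_norm_def)
  show "Linf_dist M F G = Linf_dist M G F"
    by (simp add: Linf_dist_def Linf_norm_def abs_minus_commute)
next
  fix F G assume F: "F \<in> Linf M" and G: "G \<in> Linf M"
  obtain f where f: "f \<in> F" "f \<in> ess_bounded M" "F = AE_eq_rel M `` {f}" using F by (rule Linf_rep)
  obtain g where g: "g \<in> G" "g \<in> ess_bounded M" "G = AE_eq_rel M `` {g}" using G by (rule Linf_rep)
  note [measurable] = ess_bounded_measurable[OF f(2)] ess_bounded_measurable[OF g(2)]
  have "Linf_dist M F G = 0 \<longleftrightarrow> esssup M (\<lambda>x. ennreal \<bar>f x - g x\<bar>) = 0"
    using esssup_diff_finite[OF f(2) g(2)] Linf_dist_eq[OF F f(1) G g(1)]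
    by (auto simp: Linf_norm_def enn2real_eq_0_iff)
  also have "\<dots> \<longleftrightarrow> (AE x in M. f x = g x)"
  proof
    assume 0: "esssup M (\<lambda>x. ennreal \<bar>f x - g x\<bar>) = 0"
    show "AE x in M. f x = g x"
      using esssup_AE[of "\<lambda>x. ennreal \<bar>f x - g x\<bar>" M] unfolding 0
      by eventually_elim simp
  next
    assume "AE x in M. f x = g x"
    then have "AE x in M. ennreal \<bar>f x - g x\<bar> \<le> 0"
      by eventually_elim simp
    then have "esssup M (\<lambda>x. ennreal \<bar>f x - g x\<bar>) \<le> 0"
      by (intro esssup_I) auto
    then show "esssup M (\<lambda>x. ennreal \<bar>f x - g x\<bar>) = 0"
      by simp
  qed
  also have "\<dots> \<longleftrightarrow> (f, g) \<in> AE_eq_rel M"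
    using f g by (simp add: AE_eq_rel_def)
  also have "\<dots> \<longleftrightarrow> F = G"
    using F G f(1) g(1) quotient_eq_iff[OF equiv_AE_eq_rel] unfolding Linf_def by blast
  finally show "Linf_dist M F G = 0 \<longleftrightarrow> F = G" .
next
  fix F G H assume F: "F \<in> Linf M" and G: "G \<in> Linf M" and H: "H \<in> Linf M"
  obtain f where f: "f \<in> F" "f \<in> ess_bounded M" using F by (rule Linf_rep)
  obtain g where g: "g \<in> G" "g \<in> ess_bounded M" using G by (rule Linf_rep)
  obtain h where h: "h \<in> H" "h \<in> ess_bounded M" using H by (rule Linf_rep)
  have fin: "esssup M (\<lambda>x. ennreal \<bar>f x - g x\<bar>) < \<infinity>" "esssup M (\<lambda>x. ennreal \<bar>g x - h x\<bar>) < \<infinity>"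
    using esssup_diff_finite f g h by blast+
  then have "Linf_norm M (\<lambda>x. f x - h x) \<le> enn2real (esssup M (\<lambda>x. ennreal \<bar>f x - g x\<bar>)
      + esssup M (\<lambda>x. ennreal \<bar>g x - h x\<bar>))"
    unfolding Linf_norm_def using f g h
    by (intro enn2real_mono esssup_diff_triangle) (auto simp: ess_bounded_measurable)
  also have "\<dots> = Linf_norm M (\<lambda>x. f x - g x) + Linf_norm M (\<lambda>x. g x - h x)"
    unfolding Linf_norm_def using fin by (simp add: enn2real_plus)
  finally show "Linf_dist M F H \<le> Linf_dist M F G + Linf_dist M G H"
    using Linf_dist_eq[OF F f(1) G g(1)] Linf_dist_eq[OF G g(1) H h(1)] Linf_dist_eq[OF F f(1) H h(1)]
    by simp
qed

definition is_atom :: "'a measure \<Rightarrow> 'a set \<Rightarrow> bool" where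
  "is_atom M A \<longleftrightarrow> A \<in> sets M \<and> emeasure M A > 0 \<and>
    (\<forall>E\<in>sets M. E \<subseteq> A \<longrightarrow> emeasure M E = 0 \<or> emeasure M (A - E) = 0)"

end

theory Submission
  imports Defs
begin

text \<open>Taking the point \<open>z\<close> itself as base point, \<open>h\<^sub>z w\<close> is close to \<open>h\<^sub>z z\<close> at \<open>y\<close> exactly
  when the triangle inequality \<open>d y w \<le> d y z + d z w\<close> is almost an equality. So the horofunction
  map is an embedding iff for every \<open>z\<close>, finitely many such near-equalities force \<open>w\<close> to be near \<open>z\<close>. If \<open>A\<close> is an
  atom with indicator \<open>e\<close>, the two test points \<open>z + e\<close> and \<open>z - e\<close> suffice, since \<open>w - z\<close> is constant on
  \<open>A\<close>. Without atoms, finitely many test functions nearly attain their norms on pairwise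
  disjoint sets of positive measure, and a \<open>\<plusminus>1\<close>-valued \<open>w\<close> of opposite sign there satisfies all the
  near-equalities at \<open>z = 0\<close>.\<close>

section \<open>Basic neighbourhoods in the topology of pointwise convergence\<close>

lemma openin_powertop_real_finite_test:
  assumes "openin (powertop_real I) S" "g \<in> S"
  obtains F \<epsilon> where "finite F" "F \<subseteq> I" "0 < \<epsilon>"
    "\<And>h. h \<in> extensional I \<Longrightarrow> (\<And>i. i \<in> F \<Longrightarrow> \<bar>h i - g i\<bar> < \<epsilon>) \<Longrightarrow> h \<in> S"
proof -
  obtain U where fin: "finite {i \<in> I. U i \<noteq> UNIV}" and op: "\<And>i. i \<in> I \<Longrightarrow> open (U i)"
    and g: "g \<in> Pi\<^sub>E I U" and sub: "Pi\<^sub>E I U \<subseteq> S"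
    using assms unfolding openin_product_topology_alt by force
  let ?F = "{i \<in> I. U i \<noteq> UNIV}"
  \<comment> \<open>Only the coordinates in \<open>?F\<close> impose a condition. Stating it for all
    small radii \<open>e\<close> lets these finitely many coordinates share a single radius.\<close>
  have "\<forall>i\<in>?F. \<forall>\<^sub>F e in at_right (0::real). ball (g i) e \<subseteq> U i"
  proof
    fix i assume i: "i \<in> ?F"
    then obtain e0 where "e0 > 0" "ball (g i) e0 \<subseteq> U i"
      using op[of i] g openE[of "U i" "g i"] by (metis (no_types, lifting) PiE_mem mem_Collect_eq)
    then show "\<forall>\<^sub>F e in at_right (0::real). ball (g i) e \<subseteq> U i"
      unfolding eventually_at_right_field by (intro exI[of _ e0]) (auto dest: order_less_trans)
  qed
  then have "\<forall>\<^sub>F e in at_right (0::real). \<forall>i\<in>?F. ball (g i) e \<subseteq> U i"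
    using fin by (rule eventually_ball_finite[rotated])
  then obtain e where e: "e > 0" "\<forall>i\<in>?F. ball (g i) e \<subseteq> U i"
    unfolding eventually_at_right_field by (metis field_lbound_gt_zero)
  show thesis
  proof (rule that[of ?F e])
    fix h assume h: "h \<in> extensional I" "\<And>i. i \<in> ?F \<Longrightarrow> \<bar>h i - g i\<bar> < e"
    have "h i \<in> U i" if "i \<in> I" for i
    proof (cases "U i = UNIV")
      case False
      then have "h i \<in> ball (g i) e"
        using h(2)[of i] that by (simp add: dist_real_def abs_minus_commute)
      then show ?thesis using e that False by blast
    qed auto
    then have "h \<in> Pi\<^sub>E I U" using h(1) by (simp add: PiE_iff)
    then show "h \<in> S" using sub by blast
  qed (use fin e in auto)
qed

lemma openin_powertop_real_test:
  assumes "finite F" "F \<subseteq> I"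
  shows "openin (powertop_real I) {h \<in> extensional I. \<forall>i\<in>F. \<bar>h i - g i\<bar> < \<epsilon>}"
proof -
  have "openin (powertop_real I) {h \<in> topspace (powertop_real I). h i \<in> ball (g i) \<epsilon>}"
    if "i \<in> F" for i
    using that assms
    by (intro openin_continuous_map_preimage[OF continuous_map_product_projection]) auto
  \<comment> \<open>Intersecting with the whole space covers empty \<open>F\<close>, where the
    intersection over \<open>F\<close> is \<open>UNIV\<close>.\<close>
  then have "openin (powertop_real I) (topspace (powertop_real I) \<inter>
      (\<Inter>i\<in>F. {h \<in> topspace (powertop_real I). h i \<in> ball (g i) \<epsilon>}))"
    using assms(1) by (subst Int_commute) (rule openin_INT)
  moreover have "topspace (powertop_real I) \<inter>
      (\<Inter>i\<in>F. {h \<in> topspace (powertop_real I). h i \<in> ball (g i) \<epsilon>})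
      = {h \<in> extensional I. \<forall>i\<in>F. \<bar>h i - g i\<bar> < \<epsilon>}"
    by (auto simp: PiE_iff extensional_def dist_real_def abs_minus_commute)
  ultimately show ?thesis by simp
qed

section \<open>The embedding property as a finite test by near-equalities\<close>

context Metric_space
begin

lemma continuous_map_horofunction:
  assumes "y0 \<in> M"
  shows "continuous_map mtopology (powertop_real M) (horofunction y0)"
proof -
  have "continuous_map mtopology euclideanreal (\<lambda>z. d y z - d y0 z)" if "y \<in> M" for y
    using \<open>y0 \<in> M\<close> that
      continuous_map_mdist[of mtopology "metric (M, d)" "\<lambda>_. y" "\<lambda>z. z" for y]
    by (intro continuous_map_diff) (simp_all add: mtopology_of_def)
  then show ?thesis
    by (auto simp: continuous_map_componentwise horofunction_def)
qed

text \<open>The test is openness of the horofunction map at \<open>z\<close>, written out: some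
  basic neighbourhood of the image of \<open>z\<close> has its preimage inside the ball of radius
  \<open>r\<close>. Injectivity also follows from it, because two points with the same horofunction
  cannot be told apart by any test.\<close>

lemma Gromov_compactifiable_iff_finite_test:
  "Gromov_compactifiable \<longleftrightarrow> M \<noteq> {} \<and>
    (\<forall>z\<in>M. \<forall>r>0. \<exists>F \<epsilon>. finite F \<and> F \<subseteq> M \<and> 0 < \<epsilon> \<and>
      (\<forall>w\<in>M. (\<forall>y\<in>F. d y z + d z w < d y w + \<epsilon>) \<longrightarrow> d z w < r))"
    (is "_ \<longleftrightarrow> _ \<and> ?test")
proof
  assume L: "Gromov_compactifiable"
  have ?test
  proof (intro ballI allI impI)
    fix z and r :: real assume z: "z \<in> M" and r: "r > 0"
    have emb: "embedding_map mtopology (powertop_real M) (horofunction z)"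
      using L z by (simp add: Gromov_compactifiable_iff)
    then have inj: "inj_on (horofunction z) M"
      by (auto dest: embedding_imp_closed_map simp: embedding_map_def homeomorphic_map_def)
    have "openin (subtopology (powertop_real M) (horofunction z ` M)) (horofunction z ` mball z r)"
      using emb openin_mball[of z r] homeomorphic_imp_open_map
      unfolding embedding_map_def open_map_def by fastforce
    then obtain S where S: "openin (powertop_real M) S"
      "horofunction z ` mball z r = S \<inter> horofunction z ` M"
      by (auto simp: openin_subtopology)
    have "horofunction z z \<in> S" using S(2) z r by auto
    then obtain F \<epsilon> where F: "finite F" "F \<subseteq> M" "0 < \<epsilon>"
      "\<And>h. h \<in> extensional M \<Longrightarrow> (\<And>i. i \<in> F \<Longrightarrow> \<bar>h i - horofunction z z i\<bar> < \<epsilon>) \<Longrightarrow> h \<in> S"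
      using openin_powertop_real_finite_test[OF S(1)] by metis
    have "d z w < r" if w: "w \<in> M" "\<forall>y\<in>F. d y z + d z w < d y w + \<epsilon>" for w
    proof -
      have "horofunction z w \<in> S"
      proof (rule F(4))
        fix i assume i: "i \<in> F"
        then have "i \<in> M" using F by blast
        \<comment> \<open>The difference is \<open>d i w - d z w - d i z\<close>: the triangle
          inequality makes it at most 0, the near-equality makes it exceed
          \<open>-\<epsilon>\<close>.\<close>
        then show "\<bar>horofunction z w i - horofunction z z i\<bar> < \<epsilon>"
          using w i z triangle[of i z w] F(3) by (auto simp: horofunction_def abs_less_iff)
      qed (auto simp: horofunction_def)
      then have "horofunction z w \<in> horofunction z ` mball z r" using S(2) w by auto
      then have "w \<in> mball z r" using inj w by (auto dest: inj_onD)
      then show ?thesis by simp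
    qed
    then show "\<exists>F \<epsilon>. finite F \<and> F \<subseteq> M \<and> 0 < \<epsilon> \<and>
      (\<forall>w\<in>M. (\<forall>y\<in>F. d y z + d z w < d y w + \<epsilon>) \<longrightarrow> d z w < r)"
      using F by blast
  qed
  then show "M \<noteq> {} \<and> ?test"
    using L by (auto simp: Gromov_compactifiable_def)
next
  assume R: "M \<noteq> {} \<and> ?test"
  then obtain y0 where y0: "y0 \<in> M" by blast
  have inj: "inj_on (horofunction y0) M"
  proof (rule inj_onI)
    fix z w assume zw: "z \<in> M" "w \<in> M" "horofunction y0 z = horofunction y0 w"
    \<comment> \<open>Evaluation at \<open>z\<close> gives \<open>d y0 w - d y0 z = d z w\<close>,
      which eliminates the base point from the evaluation at \<open>y\<close>. Thus \<open>w\<close>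
      passes every test at \<open>z\<close>, for every radius.\<close>
    have eq: "d y z + d z w = d y w" if "y \<in> M" for y
      using fun_cong[OF zw(3), of y] fun_cong[OF zw(3), of z] that zw(1,2)
      by (simp add: horofunction_def)
    have "d z w < r" if "r > 0" for r
    proof -
      obtain F \<epsilon> where "F \<subseteq> M" "0 < \<epsilon>"
        "\<forall>w\<in>M. (\<forall>y\<in>F. d y z + d z w < d y w + \<epsilon>) \<longrightarrow> d z w < r"
        using R zw(1) \<open>r > 0\<close> by meson
      then show ?thesis using eq zw by (metis less_add_same_cancel1 subsetD)
    qed
    from this[of "d z w"] show "z = w" using zw by (cases "d z w > 0") auto
  qed
  have "open_map mtopology (subtopology (powertop_real M) (horofunction y0 ` M)) (horofunction y0)"
    unfolding open_map_def
  proof (intro allI impI)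
    fix U assume U: "openin mtopology U"
    show "openin (subtopology (powertop_real M) (horofunction y0 ` M)) (horofunction y0 ` U)"
    proof (subst openin_subopen, safe)
      fix z assume "z \<in> U"
      with U have z: "z \<in> M" using openin_subset by force
      from U \<open>z \<in> U\<close> obtain r where r: "r > 0" "mball z r \<subseteq> U"
        by (auto simp: openin_mtopology)
      obtain F \<epsilon> where F: "finite F" "F \<subseteq> M" "0 < \<epsilon>"
        "\<forall>w\<in>M. (\<forall>y\<in>F. d y z + d z w < d y w + \<epsilon>) \<longrightarrow> d z w < r"
        using R[THEN conjunct2, rule_format, OF z r(1)] by blast
      \<comment> \<open>Here the base point is a fixed \<open>y0\<close>. The extra coordinate
        \<open>z\<close> controls \<open>d z w - d y0 w + d y0 z\<close>; subtracting the deviation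
        at \<open>y\<close> from it leaves \<open>d y z + d z w - d y w\<close>, so two errors of
        \<open>\<epsilon> / 2\<close> add up.\<close>
      let ?V = "{h \<in> extensional M. \<forall>i\<in>insert z F. \<bar>h i - horofunction y0 z i\<bar> < \<epsilon> / 2}"
      have "openin (powertop_real M) ?V"
        using F z by (intro openin_powertop_real_test) auto
      then have "openin (subtopology (powertop_real M) (horofunction y0 ` M))
          (?V \<inter> horofunction y0 ` M)"
        unfolding openin_subtopology by blast
      moreover have "horofunction y0 z \<in> ?V \<inter> horofunction y0 ` M"
        using F z by (auto simp: horofunction_def)
      moreover have "?V \<inter> horofunction y0 ` M \<subseteq> horofunction y0 ` U"
      proof (clarify, rule imageI)
        fix w assume w: "w \<in> M"
          "\<forall>i\<in>insert z F. \<bar>horofunction y0 w i - horofunction y0 z i\<bar> < \<epsilon> / 2"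
        have "d y z + d z w < d y w + \<epsilon>" if "y \<in> F" for y
        proof -
          have "y \<in> M" using that F by blast
          moreover have "\<bar>horofunction y0 w y - horofunction y0 z y\<bar> < \<epsilon> / 2"
            "\<bar>horofunction y0 w z - horofunction y0 z z\<bar> < \<epsilon> / 2"
            using w(2) that by auto
          ultimately show ?thesis using z by (simp add: horofunction_def) argo
        qed
        then have "w \<in> mball z r" using F(4) w(1) z by simp
        then show "w \<in> U" using r by blast
      qed
      ultimately show "\<exists>T. openin (subtopology (powertop_real M) (horofunction y0 ` M)) T \<and>
          horofunction y0 z \<in> T \<and> T \<subseteq> horofunction y0 ` U"
        by blast
    qed
  qed
  moreover have "continuous_map mtopology (subtopology (powertop_real M) (horofunction y0 ` M))
      (horofunction y0)"
    using continuous_map_horofunction[OF y0] by (auto simp: continuous_map_in_subtopology)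
  ultimately have "embedding_map mtopology (powertop_real M) (horofunction y0)"
    unfolding embedding_map_def
    by (intro bijective_open_imp_homeomorphic_map)
      (use inj in \<open>auto simp: horofunction_def\<close>)
  then show "Gromov_compactifiable" using y0 by (auto simp: Gromov_compactifiable_def)
qed

end

section \<open>Estimates for the essential supremum norm, and functions on an atom\<close>

lemma Linf_norm_nonneg [simp]: "0 \<le> Linf_norm M f"
  by (simp add: Linf_norm_def)

lemma ess_boundedI:
  assumes "f \<in> borel_measurable M" "AE x in M. \<bar>f x\<bar> \<le> c"
  shows "f \<in> ess_bounded M"
proof -
  have "esssup M (\<lambda>x. ennreal \<bar>f x\<bar>) \<le> ennreal c"
    using assms by (intro esssup_I) (auto elim!: eventually_mono intro: ennreal_leI)
  then show ?thesis using assms by (auto simp: ess_bounded_def intro: le_less_trans)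
qed

text \<open>The condition \<open>0 \<le> c\<close> matters on a null space: there a negative bound
  holds vacuously while the norm is 0.\<close>

lemma Linf_norm_le:
  assumes "f \<in> borel_measurable M" "AE x in M. \<bar>f x\<bar> \<le> c" "0 \<le> c"
  shows "Linf_norm M f \<le> c"
proof -
  have "esssup M (\<lambda>x. ennreal \<bar>f x\<bar>) \<le> ennreal c"
    using assms by (intro esssup_I) (auto elim!: eventually_mono intro: ennreal_leI)
  then show ?thesis using assms(3) by (simp add: Linf_norm_def enn2real_leI)
qed

lemma Linf_norm_AE:
  assumes "f \<in> ess_bounded M"
  shows "AE x in M. \<bar>f x\<bar> \<le> Linf_norm M f"
  using esssup_AE[of "\<lambda>x. ennreal \<bar>f x\<bar>" M]
proof eventually_elim
  case (elim x)
  have "esssup M (\<lambda>x. ennreal \<bar>f x\<bar>) = ennreal (Linf_norm M f)"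
    using assms by (simp add: Linf_norm_def ess_bounded_def)
  then show ?case using elim by simp
qed

text \<open>Otherwise the almost-everywhere bound by the norm would make \<open>B\<close> null. All
  lower bounds on norms of differences below come from this.\<close>

lemma Linf_norm_greater:
  assumes f: "f \<in> ess_bounded M"
    and B: "B \<in> sets M" "emeasure M B > 0" "\<And>x. x \<in> B \<Longrightarrow> c < \<bar>f x\<bar>"
  shows "c < Linf_norm M f"
proof (rule ccontr)
  assume "\<not> c < Linf_norm M f"
  with Linf_norm_AE[OF f] have "AE x in M. x \<notin> B"
    by (auto elim!: eventually_mono dest!: B(3))
  then show False using B(1,2) by (simp add: AE_iff_null_sets[symmetric] null_sets_def)
qed

lemma ess_bounded_diff:
  assumes "f \<in> ess_bounded M" "g \<in> ess_bounded M"
  shows "(\<lambda>x. f x - g x) \<in> ess_bounded M"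
  using esssup_diff_finite[OF assms] assms by (auto simp: ess_bounded_def)

lemma ess_bounded_indicator: "A \<in> sets M \<Longrightarrow> indicator A \<in> ess_bounded M"
  by (rule ess_boundedI[of _ _ 1]) (auto simp: indicator_def)

lemma ess_bounded_add:
  assumes "f \<in> ess_bounded M" "g \<in> ess_bounded M"
  shows "(\<lambda>x. f x + g x) \<in> ess_bounded M"
proof -
  have "(\<lambda>x. - g x) \<in> ess_bounded M" using assms by (auto simp: ess_bounded_def)
  from ess_bounded_diff[OF assms(1) this] show ?thesis by simp
qed

lemma ess_bounded_class:
  assumes "f \<in> ess_bounded M"
  shows "AE_eq_rel M `` {f} \<in> Linf M" "f \<in> AE_eq_rel M `` {f}"
  using assms equiv_class_self[OF equiv_AE_eq_rel]
  by (auto simp: Linf_def intro: quotientI)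

text \<open>The position of \<open>f\<close> relative to each rational is almost everywhere constant on the atom.\<close>

lemma atom_AE_const:
  fixes f :: "'a \<Rightarrow> real"
  assumes A: "is_atom M A" and f [measurable]: "f \<in> borel_measurable M"
  obtains c where "AE x in M. x \<in> A \<longrightarrow> f x = c"
proof -
  have [measurable]: "A \<in> sets M" and pos: "emeasure M A > 0"
    using A by (auto simp: is_atom_def)
  have "\<exists>b. AE x in M. x \<in> A \<longrightarrow> (f x < q) = b" for q
  proof -
    define E where "E = {x \<in> space M. x \<in> A \<and> f x < q}"
    have E [measurable]: "E \<in> sets M" by (simp add: E_def)
    have "E \<subseteq> A" by (auto simp: E_def)
    then have "emeasure M E = 0 \<or> emeasure M (A - E) = 0"
      using A E by (simp add: is_atom_def)
    then show ?thesis
    proof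
      assume "emeasure M E = 0"
      then have "AE x in M. x \<notin> E" by (intro AE_not_in) (simp add: null_sets_def)
      then have "AE x in M. x \<in> A \<longrightarrow> (f x < q) = False"
        using AE_space by eventually_elim (auto simp: E_def)
      then show ?thesis by blast
    next
      assume "emeasure M (A - E) = 0"
      then have "AE x in M. x \<notin> A - E" by (intro AE_not_in) (simp add: null_sets_def)
      then have "AE x in M. x \<in> A \<longrightarrow> (f x < q) = True"
        by eventually_elim (auto simp: E_def)
      then show ?thesis by blast
    qed
  qed
  then obtain b where b: "\<And>q. AE x in M. x \<in> A \<longrightarrow> (f x < q) = b q" by metis
  \<comment> \<open>Countability of the rationals merges the exceptional null sets into one.\<close>
  have "AE x in M. \<forall>q\<in>\<rat>. x \<in> A \<longrightarrow> (f x < q) = b q"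
    using b by (subst AE_ball_countable) (auto simp: countable_rat)
  then have AE: "AE x in M. x \<in> A \<longrightarrow> (\<forall>q\<in>\<rat>. (f x < q) = b q)"
    by eventually_elim auto
  \<comment> \<open>Since \<open>A\<close> is not null, some point of it lies outside the
    exceptional set; its value serves as the constant, by density of the rationals.\<close>
  have "\<exists>x0\<in>A. \<forall>q\<in>\<rat>. (f x0 < q) = b q"
  proof (rule ccontr)
    assume "\<not> ?thesis"
    with AE have "AE x in M. x \<notin> A" by (auto elim!: eventually_mono)
    then show False using pos by (simp add: AE_iff_null_sets[symmetric] null_sets_def)
  qed
  then obtain x0 where x0: "x0 \<in> A" "\<forall>q\<in>\<rat>. (f x0 < q) = b q" by blast
  have "AE x in M. x \<in> A \<longrightarrow> f x = f x0"
    using AE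
  proof eventually_elim
    case (elim x)
    show ?case
    proof
      assume "x \<in> A"
      then have same: "\<forall>q\<in>\<rat>. (f x < q) = (f x0 < q)" using elim x0 by auto
      show "f x = f x0"
      proof (cases "f x" "f x0" rule: linorder_cases)
        case less
        then obtain q where "q \<in> \<rat>" "f x < q" "q < f x0" using Rats_dense_in_real by blast
        then show ?thesis using same by auto
      next
        case greater
        then obtain q where "q \<in> \<rat>" "f x0 < q" "q < f x" using Rats_dense_in_real by blast
        then show ?thesis using same by auto
      qed
    qed
  qed
  then show thesis by (rule that)
qed

section \<open>Atomless measures and near-maximal sets\<close>

lemma atomless_split:
  assumes "\<And>A. \<not> is_atom M A" "A \<in> sets M" "emeasure M A > 0"
  obtains C D where "C \<in> sets M" "D \<in> sets M" "C \<subseteq> A" "D \<subseteq> A" "C \<inter> D = {}"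
    "emeasure M C > 0" "emeasure M D > 0"
proof -
  obtain E where "E \<in> sets M" "E \<subseteq> A" "emeasure M E \<noteq> 0" "emeasure M (A - E) \<noteq> 0"
    using assms unfolding is_atom_def by blast
  then show thesis
    using assms(2) by (intro that[of E "A - E"]) (auto simp: zero_less_iff_neq_zero)
qed

text \<open>Induction on the index set. If the new set meets some earlier \<open>B i\<close> in
  positive measure, that overlap is split in two: one piece replaces \<open>B i\<close>, the other
  serves the new index. If all overlaps are null, they are removed from the new set without changing
  its measure.\<close>

lemma atomless_disjoint_refinement:
  assumes na: "\<And>A. \<not> is_atom M A" and "finite I"
    and "\<And>i. i \<in> I \<Longrightarrow> A i \<in> sets M \<and> emeasure M (A i) > 0"
  shows "\<exists>B. disjoint_family_on B I \<and>
    (\<forall>i\<in>I. B i \<in> sets M \<and> B i \<subseteq> A i \<and> emeasure M (B i) > 0)"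
  using assms(2,3)
proof (induction I rule: finite_induct)
  case empty
  then show ?case by (auto simp: disjoint_family_on_def)
next
  case (insert j I)
  then obtain B where B: "disjoint_family_on B I"
    "\<forall>i\<in>I. B i \<in> sets M \<and> B i \<subseteq> A i \<and> emeasure M (B i) > 0"
    by auto
  have Aj: "A j \<in> sets M" "emeasure M (A j) > 0" using insert by auto
  show ?case
  proof (cases "\<exists>i\<in>I. emeasure M (A j \<inter> B i) > 0")
    case True
    then obtain i where i: "i \<in> I" "emeasure M (A j \<inter> B i) > 0" by blast
    have "A j \<inter> B i \<in> sets M" using Aj B i by auto
    from atomless_split[OF na this i(2)] obtain C D where CD:
      "C \<in> sets M" "D \<in> sets M" "C \<subseteq> A j \<inter> B i" "D \<subseteq> A j \<inter> B i" "C \<inter> D = {}"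
      "emeasure M C > 0" "emeasure M D > 0" .
    have ne: "i \<noteq> j" using i insert by auto
    show ?thesis
    proof (intro exI[of _ "B(i := C, j := D)"] conjI)
      \<comment> \<open>Both pieces lie in the old \<open>B i\<close>, hence miss all the other
        members.\<close>
      show "disjoint_family_on (B(i := C, j := D)) (insert j I)"
        using B(1) CD(3,4,5) i ne insert.hyps
        unfolding disjoint_family_on_def by (simp, blast)
      show "\<forall>k\<in>insert j I. (B(i := C, j := D)) k \<in> sets M \<and>
          (B(i := C, j := D)) k \<subseteq> A k \<and> emeasure M ((B(i := C, j := D)) k) > 0"
        using B(2) CD i ne subset_trans[of C "B i" "A i"] by simp
    qed
  next
    case False
    let ?D = "A j - (\<Union>i\<in>I. B i)"
    have U: "(\<Union>i\<in>I. A j \<inter> B i) \<in> null_sets M"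
      using False B(2) Aj insert.hyps
      by (intro null_sets_UN' countable_finite) (auto simp: null_sets_def)
    have "emeasure M ?D = emeasure M (A j - (\<Union>i\<in>I. A j \<inter> B i))"
      by (rule arg_cong[of _ _ "emeasure M"]) auto
    also have "\<dots> = emeasure M (A j)"
      using U Aj(1) by (rule emeasure_Diff_null_set)
    finally have D: "emeasure M ?D > 0" using Aj by simp
    show ?thesis
    proof (intro exI[of _ "B(j := ?D)"] conjI)
      show "disjoint_family_on (B(j := ?D)) (insert j I)"
        using B(1) insert.hyps unfolding disjoint_family_on_def by (simp, blast)
      show "\<forall>k\<in>insert j I. (B(j := ?D)) k \<in> sets M \<and>
          (B(j := ?D)) k \<subseteq> A k \<and> emeasure M ((B(j := ?D)) k) > 0"
        using B(2) Aj D insert.hyps by auto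
    qed
  qed
qed

text \<open>If the sets for both signs were null, \<open>\<bar>f\<bar>\<close> would be bounded
  almost everywhere by less than its norm. The sign \<open>s\<close> tells whether \<open>f\<close>
  or \<open>-f\<close> comes close to the norm.\<close>

lemma Linf_norm_nearly_attained:
  assumes f: "f \<in> ess_bounded M" and pos: "emeasure M (space M) > 0" and \<epsilon>: "0 < \<epsilon>"
  shows "\<exists>s. (s = 1 \<or> s = - 1) \<and> emeasure M {x \<in> space M. Linf_norm M f - \<epsilon> < s * f x} > 0"
proof -
  note [measurable] = ess_bounded_measurable[OF f]
  let ?A = "\<lambda>s. {x \<in> space M. Linf_norm M f - \<epsilon> < s * f x}"
  have "emeasure M (?A 1) > 0 \<or> emeasure M (?A (-1)) > 0"
  proof (rule ccontr)
    assume "\<not> ?thesis"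
    then have "?A 1 \<in> null_sets M" "?A (-1) \<in> null_sets M"
      by (auto simp: null_sets_def)
    then have "AE x in M. x \<notin> ?A 1" "AE x in M. x \<notin> ?A (-1)"
      by (blast intro: AE_not_in)+
    then have AE: "AE x in M. \<bar>f x\<bar> \<le> Linf_norm M f - \<epsilon>"
      using AE_space by eventually_elim auto
    show False
    \<comment> \<open>A negative bound is out of reach of \<open>Linf_norm_le\<close>, but no
      absolute value satisfies it, and the space is not null.\<close>
    proof (cases "Linf_norm M f - \<epsilon> \<ge> 0")
      case True
      then show False using Linf_norm_le[OF _ AE] \<epsilon> by simp
    next
      case False
      with AE have "AE x in M. False" by (auto elim!: eventually_mono)
      then show False using pos by (simp add: eventually_False ae_filter_eq_bot_iff)
    qed
  qed
  then show ?thesis by blast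
qed

section \<open>The null, the atomic and the atomless case\<close>

lemma Linf_null_Gromov_compactifiable:
  assumes "emeasure M (space M) = 0"
  shows "Metric_space.Gromov_compactifiable (Linf M) (Linf_dist M)"
proof -
  interpret L: Metric_space "Linf M" "Linf_dist M" by (rule Metric_space_Linf)
  have "(\<lambda>_. 0) \<in> ess_bounded M" by (rule ess_boundedI[of _ _ 0]) auto
  then have ne: "Linf M \<noteq> {}" using ess_bounded_class by blast
  have zero: "Linf_dist M Z W = 0" if "Z \<in> Linf M" "W \<in> Linf M" for Z W
  proof -
    obtain f g where fg: "f \<in> Z" "f \<in> ess_bounded M" "g \<in> W" "g \<in> ess_bounded M"
      using \<open>Z \<in> Linf M\<close> \<open>W \<in> Linf M\<close> by (metis Linf_rep)
    have "space M \<in> null_sets M" using assms by (simp add: null_sets_def)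
    then have "AE x in M. x \<notin> space M" by (rule AE_not_in)
    then have "AE x in M. \<bar>f x - g x\<bar> \<le> 0" using AE_space by eventually_elim auto
    then have "Linf_norm M (\<lambda>x. f x - g x) \<le> 0"
      using fg by (intro Linf_norm_le) (auto simp: ess_bounded_def)
    then show ?thesis
      using Linf_dist_eq[OF that(1) fg(1) that(2) fg(3)] by (simp add: order_antisym)
  qed
  show ?thesis
    unfolding L.Gromov_compactifiable_iff_finite_test
  proof (intro conjI ballI allI impI ne)
    fix Z and r :: real assume "Z \<in> Linf M" "r > 0"
    \<comment> \<open>All distances vanish, so the empty set of test points suffices.\<close>
    then have "\<forall>W\<in>Linf M. Linf_dist M Z W < r" using zero by metis
    then show "\<exists>F \<epsilon>. finite F \<and> F \<subseteq> Linf M \<and> 0 < \<epsilon> \<and> (\<forall>W\<in>Linf M.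
        (\<forall>Y\<in>F. Linf_dist M Y Z + Linf_dist M Z W < Linf_dist M Y W + \<epsilon>) \<longrightarrow> Linf_dist M Z W < r)"
      by (intro exI[of _ "{}"] exI[of _ 1]) auto
  qed
qed

text \<open>The perturbation acts only on \<open>A\<close>, where \<open>u\<close> has the single
  value \<open>t\<close>; elsewhere the old norm still bounds \<open>u\<close>.\<close>

lemma Linf_norm_add_atom_le:
  assumes A: "A \<in> sets M" and u: "u \<in> ess_bounded M"
    and t: "AE x in M. x \<in> A \<longrightarrow> u x = t"
  shows "Linf_norm M (\<lambda>x. u x + s * indicator A x) \<le> max \<bar>t + s\<bar> (Linf_norm M u)"
proof (rule Linf_norm_le)
  show "AE x in M. \<bar>u x + s * indicator A x\<bar> \<le> max \<bar>t + s\<bar> (Linf_norm M u)"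
    using t Linf_norm_AE[OF u] by eventually_elim (auto simp: indicator_def)
qed (use A ess_bounded_measurable[OF u] in auto)

lemma Linf_atom_Gromov_compactifiable:
  assumes atom: "is_atom M A"
  shows "Metric_space.Gromov_compactifiable (Linf M) (Linf_dist M)"
proof -
  interpret L: Metric_space "Linf M" "Linf_dist M" by (rule Metric_space_Linf)
  have A: "A \<in> sets M" "emeasure M A > 0" using atom by (auto simp: is_atom_def)
  define e :: "'a \<Rightarrow> real" where "e = indicator A"
  have e: "e \<in> ess_bounded M" using A by (simp add: e_def ess_bounded_indicator)
  have ne: "Linf M \<noteq> {}" using ess_bounded_class[OF e] by blast
  have norm_e: "1 \<le> Linf_norm M (\<lambda>x. s * e x)" if s: "\<bar>s\<bar> = 1" for s
  \<comment> \<open>\<open>Linf_norm_greater\<close> needs a strict pointwise bound, hence the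
    passage through all \<open>c < 1\<close>.\<close>
  proof (rule dense_le)
    fix c :: real assume "c < 1"
    have "(\<lambda>x. s * e x) \<in> ess_bounded M"
      using A s by (intro ess_boundedI[of _ _ 1]) (auto simp: e_def indicator_def)
    then show "c \<le> Linf_norm M (\<lambda>x. s * e x)"
      using A s \<open>c < 1\<close>
      by (intro less_imp_le Linf_norm_greater[of _ _ A]) (auto simp: e_def)
  qed
  show ?thesis
    unfolding L.Gromov_compactifiable_iff_finite_test
  proof (intro conjI ballI allI impI ne)
    fix Z and r :: real assume Z: "Z \<in> Linf M" and r: "r > 0"
    obtain f where f: "f \<in> Z" "f \<in> ess_bounded M" using Z by (metis Linf_rep)
    define y where "y s x = f x + s * e x" for s x
    define Y where "Y s = AE_eq_rel M `` {y s}" for s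
    have y: "y s \<in> ess_bounded M" for s
    proof -
      have "(\<lambda>x. s * e x) \<in> ess_bounded M"
        using A by (intro ess_boundedI[of _ _ "\<bar>s\<bar>"]) (auto simp: e_def indicator_def)
      then show ?thesis using ess_bounded_add[OF f(2)] by (simp add: y_def[abs_def])
    qed
    have Y: "Y s \<in> Linf M" "y s \<in> Y s" for s
      using ess_bounded_class[OF y] by (auto simp: Y_def)
    \<comment> \<open>The bound 1 prevents the maximum in \<open>bound\<close> from being
      \<open>Linf_norm M u\<close>; the bound \<open>r\<close> turns the final estimate by
      \<open>\<epsilon>\<close> into the required one.\<close>
    define \<epsilon> where "\<epsilon> = min 1 r"
    have \<epsilon>: "0 < \<epsilon>" "\<epsilon> \<le> 1" "\<epsilon> \<le> r" using r by (auto simp: \<epsilon>_def)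
    have "Linf_dist M Z W < r" if W: "W \<in> Linf M"
      and near: "\<forall>V\<in>{Y 1, Y (-1)}. Linf_dist M V Z + Linf_dist M Z W < Linf_dist M V W + \<epsilon>" for W
    proof -
      obtain g where g: "g \<in> W" "g \<in> ess_bounded M" using W by (metis Linf_rep)
      define u where "u x = f x - g x" for x
      have u: "u \<in> ess_bounded M" using ess_bounded_diff[OF f(2) g(2)] by (simp add: u_def[abs_def])
      obtain t where t: "AE x in M. x \<in> A \<longrightarrow> u x = t"
        using atom_AE_const[OF atom ess_bounded_measurable[OF u]] .
      have ZW: "Linf_dist M Z W = Linf_norm M u"
        using Linf_dist_eq[OF Z f(1) W g(1)] by (simp add: u_def[abs_def])
      have bound: "1 + Linf_norm M u < max \<bar>t + s\<bar> (Linf_norm M u) + \<epsilon>" if s: "s = 1 \<or> s = -1" for s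
      proof -
        have "Linf_dist M (Y s) Z = Linf_norm M (\<lambda>x. s * e x)"
          using Linf_dist_eq[OF Y Z f(1)] by (simp add: y_def)
        moreover have "Linf_dist M (Y s) W = Linf_norm M (\<lambda>x. u x + s * indicator A x)"
          using Linf_dist_eq[OF Y W g(1)] by (simp add: y_def u_def e_def algebra_simps)
        moreover have "Linf_dist M (Y s) Z + Linf_dist M Z W < Linf_dist M (Y s) W + \<epsilon>"
          using near s by auto
        moreover have "1 \<le> Linf_norm M (\<lambda>x. s * e x)" using s by (intro norm_e) auto
        ultimately show ?thesis
          using Linf_norm_add_atom_le[OF A(1) u t, of s] ZW by linarith
      qed
      have "\<bar>t\<bar> \<le> Linf_norm M u"
      proof (rule ccontr)
        assume "\<not> ?thesis"
        moreover have "AE x in M. x \<in> A \<longrightarrow> \<bar>t\<bar> \<le> Linf_norm M u"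
          using t Linf_norm_AE[OF u] by eventually_elim auto
        ultimately have "AE x in M. x \<notin> A" by simp
        then show False using A by (simp add: AE_iff_null_sets[symmetric] null_sets_def)
      qed
      \<comment> \<open>Take the sign \<open>s\<close> opposite to \<open>t\<close>, so that
        \<open>\<bar>t + s\<bar> = \<bar>\<bar>t\<bar> - 1\<bar>\<close>. If
        \<open>\<bar>t\<bar> \<le> 1\<close>, this is at most 1 and the claim follows; if
        \<open>\<bar>t\<bar> > 1\<close>, it is below \<open>Linf_norm M u\<close>, which
        contradicts \<open>\<epsilon> \<le> 1\<close>.\<close>
      then have "Linf_norm M u < \<epsilon>"
        using bound[of 1] bound[of "-1"] \<epsilon> by (auto simp: max_def split: if_splits)
      then show ?thesis using ZW \<epsilon> by simp
    qed
    then show "\<exists>F \<epsilon>. finite F \<and> F \<subseteq> Linf M \<and> 0 < \<epsilon> \<and> (\<forall>W\<in>Linf M.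
        (\<forall>V\<in>F. Linf_dist M V Z + Linf_dist M Z W < Linf_dist M V W + \<epsilon>) \<longrightarrow> Linf_dist M Z W < r)"
      using Y \<epsilon> by (intro exI[of _ "{Y 1, Y (-1)}"] exI[of _ \<epsilon>]) auto
  qed
qed

text \<open>The finite test fails at the class of 0 with radius 1: whatever the finite set of test
  points, some \<open>w\<close> with \<open>\<bar>w\<bar> = 1\<close> everywhere passes it.\<close>

lemma Linf_atomless_not_Gromov_compactifiable:
  assumes pos: "emeasure M (space M) > 0" and na: "\<And>A. \<not> is_atom M A"
  shows "\<not> Metric_space.Gromov_compactifiable (Linf M) (Linf_dist M)"
proof
  interpret L: Metric_space "Linf M" "Linf_dist M" by (rule Metric_space_Linf)
  assume "L.Gromov_compactifiable"
  define Z where "Z = AE_eq_rel M `` {\<lambda>_. 0}"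
  have "(\<lambda>_. 0) \<in> ess_bounded M" by (rule ess_boundedI[of _ _ 0]) auto
  then have Z: "Z \<in> Linf M" "(\<lambda>_. 0) \<in> Z"
    using ess_bounded_class by (auto simp: Z_def)
  obtain F \<epsilon> where F: "finite F" "F \<subseteq> Linf M" "0 < \<epsilon>"
    "\<forall>W\<in>Linf M. (\<forall>Y\<in>F. Linf_dist M Y Z + Linf_dist M Z W < Linf_dist M Y W + \<epsilon>)
      \<longrightarrow> Linf_dist M Z W < 1"
    using \<open>L.Gromov_compactifiable\<close>[unfolded L.Gromov_compactifiable_iff_finite_test,
        THEN conjunct2, rule_format, OF Z(1) zero_less_one] by (elim exE conjE)
  have "\<forall>Y\<in>F. \<exists>f. f \<in> Y \<and> f \<in> ess_bounded M" using F(2) by (metis Linf_rep subsetD)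
  then obtain f where f: "\<And>Y. Y \<in> F \<Longrightarrow> f Y \<in> Y" "\<And>Y. Y \<in> F \<Longrightarrow> f Y \<in> ess_bounded M" by metis
  have "\<forall>Y\<in>F. \<exists>s. (s = 1 \<or> s = - 1) \<and>
      emeasure M {x \<in> space M. Linf_norm M (f Y) - \<epsilon> < s * f Y x} > 0"
    using Linf_norm_nearly_attained[OF f(2) pos F(3)] by blast
  then obtain s where s: "\<And>Y. Y \<in> F \<Longrightarrow> s Y = 1 \<or> s Y = - 1"
    "\<And>Y. Y \<in> F \<Longrightarrow> emeasure M {x \<in> space M. Linf_norm M (f Y) - \<epsilon> < s Y * f Y x} > 0"
    by metis
  define A where "A Y = {x \<in> space M. Linf_norm M (f Y) - \<epsilon> < s Y * f Y x}" for Y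
  have "A Y \<in> sets M \<and> emeasure M (A Y) > 0" if "Y \<in> F" for Y
    using s(2)[OF that] ess_bounded_measurable[OF f(2)[OF that]] by (auto simp: A_def)
  then obtain B where disj: "disjoint_family_on B F"
    and B: "\<And>Y. Y \<in> F \<Longrightarrow> B Y \<in> sets M \<and> B Y \<subseteq> A Y \<and> emeasure M (B Y) > 0"
    using atomless_disjoint_refinement[OF na F(1), of A] by blast
  \<comment> \<open>\<open>w\<close> is -1 on \<open>S\<close> and 1 elsewhere. Disjointness keeps
    every \<open>B Y\<close> with \<open>s Y = - 1\<close> outside \<open>S\<close>, so
    \<open>w = - s Y\<close> on each \<open>B Y\<close>.\<close>
  define S where "S = (\<Union>Y\<in>{Y\<in>F. s Y = 1}. B Y)"
  have S [measurable]: "S \<in> sets M" unfolding S_def using F(1) B by (intro sets.finite_UN) auto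
  define w :: "'a \<Rightarrow> real" where "w x = 1 - 2 * indicator S x" for x
  have [measurable]: "w \<in> borel_measurable M" unfolding w_def[abs_def] by measurable
  have w_abs: "\<bar>w x\<bar> = 1" for x by (auto simp: w_def indicator_def)
  have w: "w \<in> ess_bounded M" by (rule ess_boundedI[of _ _ 1]) (auto simp: w_abs)
  define W where "W = AE_eq_rel M `` {w}"
  have W: "W \<in> Linf M" "w \<in> W" using ess_bounded_class[OF w] by (auto simp: W_def)
  have "(\<lambda>x. 0 - w x) \<in> ess_bounded M" by (rule ess_boundedI[of _ _ 1]) (auto simp: w_abs)
  have "Linf_norm M (\<lambda>x. 0 - w x) \<le> 1"
    by (rule Linf_norm_le) (auto simp: w_abs)
  then have ZW: "Linf_dist M Z W \<le> 1"
    using Linf_dist_eq[OF Z W] by simp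
  have "Linf_dist M Z W < 1"
  proof (rule F(4)[rule_format, OF W(1)])
    fix Y assume Y: "Y \<in> F"
    then have YL: "Y \<in> Linf M" using F by blast
    \<comment> \<open>On \<open>B Y\<close> the signs of \<open>s Y * f Y x\<close> and
      \<open>- s Y * w x = 1\<close> add up:
      \<open>\<bar>f Y x - w x\<bar> \<ge> s Y * f Y x + 1\<close>.\<close>
    have "Linf_norm M (f Y) + 1 - \<epsilon> < Linf_norm M (\<lambda>x. f Y x - w x)"
    proof (rule Linf_norm_greater[where B = "B Y"])
      show "(\<lambda>x. f Y x - w x) \<in> ess_bounded M" using f(2)[OF Y] w by (rule ess_bounded_diff)
      fix x assume x: "x \<in> B Y"
      then have fx: "Linf_norm M (f Y) - \<epsilon> < s Y * f Y x" using B[OF Y] by (auto simp: A_def)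
      have "w x = - s Y"
        using s(1)[OF Y]
      proof
        assume "s Y = 1"
        then show ?thesis using x Y by (auto simp: w_def S_def indicator_def)
      next
        assume sY: "s Y = - 1"
        have "x \<notin> B X" if "X \<in> F" "s X = 1" for X
          using disjoint_family_onD[OF disj that(1) Y] that sY x by fastforce
        then show ?thesis using sY by (auto simp: w_def S_def indicator_def)
      qed
      then show "Linf_norm M (f Y) + 1 - \<epsilon> < \<bar>f Y x - w x\<bar>"
        using fx s(1)[OF Y] by auto
    qed (use B[OF Y] in auto)
    moreover have "Linf_dist M Y Z = Linf_norm M (f Y)"
      using Linf_dist_eq[OF YL f(1)[OF Y] Z] by simp
    moreover have "Linf_dist M Y W = Linf_norm M (\<lambda>x. f Y x - w x)"
      using Linf_dist_eq[OF YL f(1)[OF Y] W] .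
    ultimately show "Linf_dist M Y Z + Linf_dist M Z W < Linf_dist M Y W + \<epsilon>"
      using ZW by linarith
  qed
  \<comment> \<open>The test has forced a distance below 1, yet this distance bounds
    \<open>\<bar>w\<bar> = 1\<close> almost everywhere on a space of positive measure.\<close>
  moreover have "AE x in M. \<bar>0 - w x\<bar> \<le> Linf_dist M Z W"
    using Linf_norm_AE[OF \<open>(\<lambda>x. 0 - w x) \<in> ess_bounded M\<close>] Linf_dist_eq[OF Z W] by simp
  ultimately have "AE x in M. False" by (simp add: w_abs)
  then show False using pos by (simp add: eventually_False ae_filter_eq_bot_iff)
qed

theorem theorem6p1:
  fixes M :: "'a measure"
  shows "Metric_space.Gromov_compactifiable (Linf M) (Linf_dist M) \<longleftrightarrow>
    emeasure M (space M) = 0 \<or> (\<exists>A. is_atom M A)"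
  using Linf_null_Gromov_compactifiable[of M] Linf_atom_Gromov_compactifiable[of M]
    Linf_atomless_not_Gromov_compactifiable[of M]
  by (auto simp: zero_less_iff_neq_zero)

end
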